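(* Consider the central scheme on overlapping cells (CSOC) with forward Euler time discretization (both staggered updates written out in the context), applied to the modified Saint-Venant system $$ \left\{\begin{aligned}&w_t+(hu)_x=0,\\&(hu)_t+\Big(\frac{(hu)^2}{w-B}+g[\bar w(t)-w]B+\frac{g}{2}w^2\Big)_x=g[\bar w(t)-w]B_x,\end{aligned}\right. $$ with the piecewise polynomial reconstruction performed for the equilibrium variables $\bm a=(w,hu)^T$. This scheme is well-balanced, i.e. it exactly preserves "lake at rest" steady states: if at time $t^n$ there is a constant $\hat w$ such that all cell averages of $\bm a$ over both families of cells equal the "lake at rest" value, $\bm U_i^n=\bm V_{i+\frac12}^n=(\hat w,0)^T$ for all $i$, then $\bm U_i^{n+1}=\bm V_{i+\frac12}^{n+1}=(\hat w,0)^T$ for all $i$.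
   Context: Unknowns and data: $h$ is the water depth (positive), $u$ the velocity, $B=B(x)$ the given bottom elevation (regular enough that $B_x$ is integrable on cells), $g>0$ the gravitational constant, $w:=h+B$ the water surface. The modified system is a rewriting of the 1-D Saint-Venant system $h_t+(hu)_x=0$, $(hu)_t+(hu^2+\frac12gh^2)_x=-ghB_x$. "Lake at rest" steady states are $w\equiv\mathrm{Const}$, $u\equiv0$. The equilibrium variables are $\bm a=(w,hu)^T$. For a bounded computational domain $\Omega$ of size $|\Omega|$, $\bar w(t):=\frac1{|\Omega|}\int_\Omega w(x,t)\,dx$ is the global spatial average of $w$; in the scheme at time $t^n$ it is the global spatial average $\bar w^n$ of the numerical water surface at $t^n$ (so $\bar w^n=\hat w$ when the numerical water surface is identically $\hat w$). The modified system is a balance law $\bm u_t+\bm f_x=\bm S$ with unknown $\bm u=\bm a=(w,hu)^T$, flux $\bm f=\big(hu,\ \frac{(hu)^2}{w-B}+g[\bar w-w]B+\frac g2w^2\big)^T$ and source $\bm S=\big(0,\ g[\bar w-w]B_x\big)^T$, where $\bm f$ and $\bm S$ depend on $x$ through $B$ and on $t$ through $\bar w$. Grid: $D_{i+\frac12}=[x_i,x_{i+1}]$ are cells of a uniform partition of the real line with $x_{i+1}-x_i=\Delta x$, and $C_i=[x_{i-\frac12},x_{i+\frac12}]$, with $x_{i\pm\frac12}=x_i\pm\frac{\Delta x}2$, are the cells of the staggered dual partition. $\bm V_{i+\frac12}^n$ and $\bm U_i^n$ denote the computed cell averages of $\bm a$ at time $t^n$ over $D_{i+\frac12}$ and $C_i$,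 respectively. Reconstruction: from the cell averages at $t^n$ one builds piecewise polynomial functions $\widetilde{\bm U}^n$ (polynomial on each $C_i$) and $\widetilde{\bm V}^n$ (polynomial on each $D_{i+\frac12}$) approximating $\bm a$; the reconstruction reproduces constants, i.e. if all cell averages over both families of cells equal the same constant vector, then $\widetilde{\bm U}^n$ and $\widetilde{\bm V}^n$ are identically equal to that constant vector. Scheme (forward Euler, fully discrete CSOC): with $\theta=\Delta t/\Delta\tau$, where $\Delta\tau>0$ is an upper bound for the time step $\Delta t>0$ (so $0<\theta\le1$), $t^{n+1}=t^n+\Delta t$, and $\Delta\tau$ is restricted by the CFL condition $\frac{a\Delta\tau}{\Delta x}\le\frac12$ ($a$ being the supremum of the spectral radius of the Jacobian $\partial\bm f/\partial\bm u$ over the relevant values of $\bm u$), $$ \bm V_{i+\frac12}^{n+1}=\frac{\theta}{\Delta x}\int_{x_i}^{x_{i+1}}\widetilde{\bm U}^n(x)\,dx+(1-\theta)\bm V_{i+\frac12}^n-\frac{\Delta t}{\Delta x}\big[\bm f(\widetilde{\bm U}^n(x_{i+1}))-\bm f(\widetilde{\bm U}^n(x_i))\big]+\frac{\Delta t}{\Delta x}\int_{x_i}^{x_{i+1}}\bm S(\widetilde{\bm U}^n(x),x,t^n)\,dx, $$ $$ \bm U_{i}^{n+1}=\frac{\theta}{\Delta x}\int_{x_{i-\frac12}}^{x_{i+\frac12}}\widetilde{\bm V}^n(x)\,dx+(1-\theta)\bm U_{i}^n-\frac{\Delta t}{\Delta x}\big[\bm f(\widetilde{\bm V}^n(x_{i+\frac12}))-\bm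 f(\widetilde{\bm V}^n(x_{i-\frac12}))\big]+\frac{\Delta t}{\Delta x}\int_{x_{i-\frac12}}^{x_{i+\frac12}}\bm S(\widetilde{\bm V}^n(x),x,t^n)\,dx, $$ where the flux values at a point $x_*$ use $B(x_* )$ and $\bar w=\bar w^n$. *)

theory Defs
  imports "HOL-Analysis.Analysis"
begin

(* States are the equilibrium variables a = (w, hu), with components 1 and 2. Points of the
   staggered grid: x_s is grid_pt x0 dx s for s an integer or a half-integer. *)

definition grid_pt :: "real \<Rightarrow> real \<Rightarrow> real \<Rightarrow> real" where
  "grid_pt x0 dx s = x0 + s * dx"

definition bottom_topography :: "(real \<Rightarrow> real) \<Rightarrow> bool" where
  "bottom_topography B \<longleftrightarrow>
     negligible {x. \<not> B differentiable (at x)} \<and>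
     (\<forall>a b. deriv B absolutely_integrable_on {a..b})"

(* Flux and source of the modified Saint-Venant system. The bottom enters through its value b,
   respectively its slope bx, at the point of evaluation; wbar is the global average of w. *)

definition sv_flux :: "real \<Rightarrow> real \<Rightarrow> real \<Rightarrow> real^2 \<Rightarrow> real^2" where
  "sv_flux g wbar b u =
     vector [u$2, (u$2)\<^sup>2 / (u$1 - b) + g * (wbar - u$1) * b + g / 2 * (u$1)\<^sup>2]"

definition sv_source :: "real \<Rightarrow> real \<Rightarrow> real \<Rightarrow> real^2 \<Rightarrow> real^2" where
  "sv_source g wbar bx u = vector [0, g * (wbar - u$1) * bx]"

definition spatial_average :: "real set \<Rightarrow> (real \<Rightarrow> real) \<Rightarrow> real" where
  "spatial_average \<Omega> W = integral \<Omega> W / measure lebesgue \<Omega>"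

(* The eigenvalues of a real matrix are taken in the complex numbers. *)

definition spectral_radius :: "real^'n^'n \<Rightarrow> real" where
  "spectral_radius A =
     Max (cmod ` {l. \<exists>v. v \<noteq> 0 \<and> map_matrix complex_of_real A *v v = l *s v})"

(* The relevant states at a point x are the values there of the two reconstructions. The supremum
   is an extended real, so that it is infinite when the speeds are unbounded. *)

definition max_speed ::
  "real \<Rightarrow> real \<Rightarrow> (real \<Rightarrow> real) \<Rightarrow> (real \<Rightarrow> real^2) \<Rightarrow> (real \<Rightarrow> real^2) \<Rightarrow> ereal" where
  "max_speed g wbar B Ut Vt =
     (SUP (W, x) \<in> {Ut, Vt} \<times> UNIV.
        ereal (spectral_radius (jacobian (sv_flux g wbar (B x)) (at (W x)))))"

(* U i is the average over C_i = [x_{i-1/2}, x_{i+1/2}], and V i the one over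
   D_{i+1/2} = [x_i, x_{i+1}]. The values of a reconstruction at the interfaces between its own
   cells, where the one-sided limits may differ, are left free. *)

definition csoc_reconstruction ::
  "real \<Rightarrow> real \<Rightarrow>
   ((int \<Rightarrow> real^2) \<Rightarrow> (int \<Rightarrow> real^2) \<Rightarrow> (real \<Rightarrow> real^2) \<times> (real \<Rightarrow> real^2)) \<Rightarrow> bool" where
  "csoc_reconstruction x0 dx recon \<longleftrightarrow>
     (\<forall>U V Ut Vt. recon U V = (Ut, Vt) \<longrightarrow>
        (\<forall>i. \<exists>p. polynomial_function p \<and>
           (\<forall>x \<in> {grid_pt x0 dx (of_int i - 1/2) <..< grid_pt x0 dx (of_int i + 1/2)}.
              Ut x = p x)) \<and>
        (\<forall>i. \<exists>p. polynomial_function p \<and>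
           (\<forall>x \<in> {grid_pt x0 dx (of_int i) <..< grid_pt x0 dx (of_int i + 1)}.
              Vt x = p x))) \<and>
     (\<forall>c. recon (\<lambda>i. c) (\<lambda>i. c) = (\<lambda>x. c, \<lambda>x. c))"

(* The data on overlapping cells contain several numerical water surfaces: either reconstruction,
   either family of cell averages seen as a piecewise constant function, and weighted means of
   these. The scheme may average any of them over the domain. *)

inductive water_surface ::
  "real \<Rightarrow> real \<Rightarrow> (int \<Rightarrow> real^2) \<Rightarrow> (int \<Rightarrow> real^2) \<Rightarrow>
   (real \<Rightarrow> real^2) \<Rightarrow> (real \<Rightarrow> real^2) \<Rightarrow> (real \<Rightarrow> real) \<Rightarrow> bool"
  for x0 dx U V Ut Vt where
  recon_C: "water_surface x0 dx U V Ut Vt (\<lambda>x. Ut x $ 1)"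
| recon_D: "water_surface x0 dx U V Ut Vt (\<lambda>x. Vt x $ 1)"
| averages_C: "water_surface x0 dx U V Ut Vt (\<lambda>x. U \<lfloor>(x - x0) / dx + 1/2\<rfloor> $ 1)"
| averages_D: "water_surface x0 dx U V Ut Vt (\<lambda>x. V \<lfloor>(x - x0) / dx\<rfloor> $ 1)"
| mean: "water_surface x0 dx U V Ut Vt W \<Longrightarrow> water_surface x0 dx U V Ut Vt W' \<Longrightarrow>
    0 \<le> \<kappa> \<Longrightarrow> \<kappa> \<le> 1 \<Longrightarrow>
    water_surface x0 dx U V Ut Vt (\<lambda>x. \<kappa> * W x + (1 - \<kappa>) * W' x)"

(* Forward Euler update of the average avg over the cell [a, b] of one family, from the
   reconstruction W on the other family. *)

definition csoc_update ::
  "real \<Rightarrow> real \<Rightarrow> (real \<Rightarrow> real) \<Rightarrow> real \<Rightarrow> real \<Rightarrow> real \<Rightarrow>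
   (real \<Rightarrow> real^2) \<Rightarrow> real \<Rightarrow> real \<Rightarrow> real^2 \<Rightarrow> real^2" where
  "csoc_update g wbar B dx dt \<theta> W a b avg =
     (\<theta> / dx) *\<^sub>R integral {a..b} W + (1 - \<theta>) *\<^sub>R avg
     - (dt / dx) *\<^sub>R (sv_flux g wbar (B b) (W b) - sv_flux g wbar (B a) (W a))
     + (dt / dx) *\<^sub>R integral {a..b} (\<lambda>x. sv_source g wbar (deriv B x) (W x))"

end

theory Submission
  imports Defs
begin

text \<open>
  Written in the equilibrium variables \<open>(w, hu)\<close>, a lake at rest is a spatially constant state,
  although the depth \<open>h = w - B\<close> varies with the bottom. A reconstruction that reproduces constants
  is therefore exact on it, and the average of the two families of cells that the staggered scheme
  takes creates no error. It remains to see that the scheme is in equilibrium at this state.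

  All terms of the modified system in which the bottom survives at zero velocity carry the factor
  \<open>wbar - w\<close>. At rest, every numerical water surface is the constant \<open>what\<close>
  (\<open>water_surface_at_rest\<close>), so its average over the domain is also \<open>what\<close>
  (\<open>spatial_average_const\<close>) and this factor vanishes. Then the source is zero, and the flux
  \<open>(0, g what^2 / 2)\<close> no longer depends on the position, so that its differences across cells cancel
  exactly (\<open>sv_flux_at_rest\<close>, \<open>sv_source_at_rest\<close>). What is left of the update is the mean, with
  weights \<open>\<theta>\<close> and \<open>1 - \<theta>\<close>, of two averages of the same constant (\<open>csoc_update_at_rest\<close>).
\<close>

text \<open>Boundedness of the domain is what gives it finite measure, so that the constant is integrable
  and the quotient is meaningful.\<close>
lemma spatial_average_const:
  assumes "bounded \<Omega>" and "\<Omega> \<in> sets lebesgue" and "measure lebesgue \<Omega> > 0"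
  shows "spatial_average \<Omega> (\<lambda>x. c) = c"
proof -
  have "\<Omega> \<in> lmeasurable"
    using assms(1,2) by (rule bounded_set_imp_lmeasurable)
  then have "integral \<Omega> (\<lambda>x. c * 1) = c * measure lebesgue \<Omega>"
    by (subst integral_mult_right) (simp add: lmeasure_integral)
  then show ?thesis
    using assms(3) by (simp add: spatial_average_def)
qed

text \<open>The four basic surfaces are all equal to \<open>what\<close>, and a mean of two equal constants is
  that constant.\<close>
lemma water_surface_at_rest:
  assumes "water_surface x0 dx (\<lambda>i. vector [what, q]) (\<lambda>i. vector [what, q])
             (\<lambda>x. vector [what, q]) (\<lambda>x. vector [what, q]) W"
  shows "W = (\<lambda>x. what)"
  using assms by induction (auto simp: algebra_simps)

text \<open>The right-hand side is free of the bottom elevation \<open>b\<close>. This is where the modified form of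
  the momentum flux matters: the term in \<open>b\<close> is multiplied by the deviation of the surface from its
  average.\<close>
lemma sv_flux_at_rest:
  "sv_flux g what b (vector [what, 0]) = vector [0, g / 2 * what\<^sup>2]"
  by (simp add: sv_flux_def)

lemma sv_source_at_rest: "sv_source g what bx (vector [what, q]) = 0"
  by (simp add: sv_source_def vec_eq_iff forall_2)

text \<open>A single statement serves both families of cells: only the length of the cell matters.\<close>
lemma csoc_update_at_rest:
  assumes "dx > 0" and "b - a = dx"
  shows "csoc_update g what B dx dt \<theta> (\<lambda>x. vector [what, 0]) a b (vector [what, 0])
           = vector [what, 0]"
proof -
  let ?c = "vector [what, 0] :: real^2"
  have "b = a + dx"
    using assms(2) by simp
  then have "csoc_update g what B dx dt \<theta> (\<lambda>x. ?c) a b ?c = \<theta> *\<^sub>R ?c + (1 - \<theta>) *\<^sub>R ?c"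
    using assms(1) by (simp add: csoc_update_def sv_flux_at_rest sv_source_at_rest)
  also have "\<dots> = ?c"
    by (simp flip: scaleR_add_left)
  finally show ?thesis .
qed

theorem theorem3p1:
  fixes g x0 dx dt dtau \<theta> wbar what :: real
    and B W :: "real \<Rightarrow> real" and \<Omega> :: "real set"
    and recon :: "(int \<Rightarrow> real^2) \<Rightarrow> (int \<Rightarrow> real^2) \<Rightarrow>
                  (real \<Rightarrow> real^2) \<times> (real \<Rightarrow> real^2)"
    and U V :: "nat \<Rightarrow> int \<Rightarrow> real^2"
    and Ut Vt :: "real \<Rightarrow> real^2"
    and n :: nat
  assumes "g > 0" and "dx > 0" and "bottom_topography B"
    and "bounded \<Omega>" and "\<Omega> \<in> sets lebesgue" and "measure lebesgue \<Omega> > 0"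
    and "csoc_reconstruction x0 dx recon"
    and "recon (U n) (V n) = (Ut, Vt)"
    and "water_surface x0 dx (U n) (V n) Ut Vt W"
    and "wbar = spatial_average \<Omega> W"
    and "0 < dt" and "dt \<le> dtau" and "\<theta> = dt / dtau"
    and "max_speed g wbar B Ut Vt * ereal dtau / ereal dx \<le> 1 / 2"
    and "\<forall>i. V (Suc n) i = csoc_update g wbar B dx dt \<theta> Ut
           (grid_pt x0 dx (of_int i)) (grid_pt x0 dx (of_int i + 1)) (V n i)"
    and "\<forall>i. U (Suc n) i = csoc_update g wbar B dx dt \<theta> Vt
           (grid_pt x0 dx (of_int i - 1/2)) (grid_pt x0 dx (of_int i + 1/2)) (U n i)"
    and "\<forall>x. what - B x > 0"
    and "\<forall>i. U n i = vector [what, 0] \<and> V n i = vector [what, 0]"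
  shows "\<forall>i. U (Suc n) i = vector [what, 0] \<and> V (Suc n) i = vector [what, 0]"
proof -
  let ?c = "vector [what, 0] :: real^2"
  have averages: "U n = (\<lambda>i. ?c)" "V n = (\<lambda>i. ?c)"
    using assms(18) by auto
  have recon: "Ut = (\<lambda>x. ?c)" "Vt = (\<lambda>x. ?c)"
    using assms(7,8) unfolding averages csoc_reconstruction_def by auto
  have "W = (\<lambda>x. what)"
    using assms(9) unfolding averages recon by (rule water_surface_at_rest)
  then have wbar: "wbar = what"
    using assms(4-6,10) by (simp add: spatial_average_const)
  show ?thesis
    using assms(2,15,16) unfolding averages recon wbar
    by (simp add: csoc_update_at_rest grid_pt_def algebra_simps)
qed

end
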